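(* Let $A:[0,+\infty)\to M_{n\times n}(\mathbb{R})$ be measurable and bounded on finite intervals, and let $\Phi_A(t,s)$ be the transition matrix of the linear system $\dot{x}=A(t)x$. The following properties are equivalent: (i) There exist constants $K>1$ and $\beta>0$ such that $\|\Phi_A(t,s)\|\leq Ke^{\beta|t-s|}$ for any $t,s\in[0,+\infty)$. (ii) The system satisfies Kalman's condition: there exists a function $\alpha:[0,+\infty)\to(0,+\infty)$ with $\alpha\in\mathcal{B}$ such that $\|\Phi_A(t,s)\|\leq\alpha(|t-s|)$ for all $t,s\in[0,+\infty)$. (iii) For any $h>0$ there exists $C_h>1$ such that any solution $t\mapsto x(t)$ of $\dot{x}=A(t)x$ verifies $|x(t)|\leq C_h|x(s)|$ for any $t\in[s-h,s+h]$ (with $t,s\in[0,+\infty)$).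
   Context: $|\cdot|$ is the Euclidean norm on $\mathbb{R}^n$ and $\|\cdot\|$ the induced matrix norm. $\mathcal{B}$ denotes the set of real functions mapping bounded sets into bounded sets. *)

theory Defs
  imports "HOL-Analysis.Analysis"
begin

text \<open>
  The epsilon-delta notion of absolute continuity. A finite family of non-overlapping compact
  intervals is a set \<open>d\<close> with \<open>d division_of \<Union>d\<close>; the end points of \<open>k \<in> d\<close>
  are \<open>Inf k\<close> and \<open>Sup k\<close>.
\<close>

definition absolutely_continuous_on :: "real set \<Rightarrow> (real \<Rightarrow> 'a::real_normed_vector) \<Rightarrow> bool" where
  "absolutely_continuous_on S f \<longleftrightarrow>
     (\<forall>\<epsilon>>0. \<exists>\<delta>>0. \<forall>d. d division_of \<Union>d \<and> \<Union>d \<subseteq> S \<and> (\<Sum>k\<in>d. measure lborel k) < \<delta> \<longrightarrow>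
        (\<Sum>k\<in>d. norm (f (Sup k) - f (Inf k))) < \<epsilon>)"

text \<open>
  Solutions on \<open>[0,\<infinity>)\<close> of \<open>x' = f(t,x)\<close>, in the sense of Caratheodory because the right-hand
  side is only measurable in \<open>t\<close>: locally absolutely continuous functions that satisfy the equation
  almost everywhere.
\<close>

definition caratheodory_solution ::
    "(real \<Rightarrow> 'a \<Rightarrow> 'a) \<Rightarrow> (real \<Rightarrow> 'a::real_normed_vector) \<Rightarrow> bool" where
  "caratheodory_solution f x \<longleftrightarrow>
     (\<forall>T\<ge>0. absolutely_continuous_on {0..T} x) \<and>
     (AE t in lborel. 0 \<le> t \<longrightarrow> (x has_vector_derivative f t (x t)) (at t within {0..}))"

text \<open>
  \<open>transition_matrix A t s\<close> is the value at time \<open>t\<close> of the solution of the matrix equation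
  \<open>X' = A(t) X\<close>, \<open>X(s) = I\<close>, for \<open>t, s \<ge> 0\<close> in either order. Only the value at \<open>t\<close> is described
  uniquely, since a solution is unconstrained at negative times.
\<close>

definition transition_matrix :: "(real \<Rightarrow> real^'n^'n) \<Rightarrow> real \<Rightarrow> real \<Rightarrow> real^'n^'n" where
  "transition_matrix A t s =
     (THE M. \<exists>X. caratheodory_solution (\<lambda>u Y. A u ** Y) X \<and> X s = mat 1 \<and> X t = M)"

definition maps_bounded_sets_on :: "real set \<Rightarrow> (real \<Rightarrow> real) \<Rightarrow> bool" where
  "maps_bounded_sets_on D f \<longleftrightarrow> (\<forall>S\<subseteq>D. bounded S \<longrightarrow> bounded (f ` S))"

definition kalman_condition :: "(real \<Rightarrow> real^'n^'n) \<Rightarrow> bool" where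
  "kalman_condition A \<longleftrightarrow>
     (\<exists>\<alpha>. (\<forall>r\<ge>0. 0 < \<alpha> r) \<and> maps_bounded_sets_on {0..} \<alpha> \<and>
        (\<forall>t\<ge>0. \<forall>s\<ge>0. onorm ((*v) (transition_matrix A t s)) \<le> \<alpha> \<bar>t - s\<bar>))"

end

(*
  For a linear system with locally bounded measurable coefficients, absolute continuity together
  with the equation almost everywhere amounts to the integral equation. One direction is a
  fundamental theorem of calculus in which the gauge is chosen inside a small open neighbourhood
  of the exceptional null set; the other is Lebesgue differentiation. Picard iteration then gives
  existence and uniqueness through any point (s, v), so that x(t) = Phi(t,s) x(s) for every
  solution x. Hence a bound on the growth of all solutions is the same as a bound on Phi, and the
  bound C on unit time steps iterates to C^n over n steps, i.e. to an exponential bound with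
  exponent ln C.
*)
theory Submission
  imports Defs
begin

section \<open>Calculus for absolutely continuous functions\<close>

text \<open>Outer regularity encloses the null set \<open>N\<close> in an open \<open>U\<close> of
  measure below the \<delta> of absolute continuity. Non-overlapping intervals inside
  \<open>U\<close> then have total length below \<delta>, so \<open>f\<close> varies by less than
  \<open>e\<close> over them, wherever their tags lie.\<close>

lemma absolutely_continuous_on_small_cover:
  fixes f :: "real \<Rightarrow> 'a::real_normed_vector"
  assumes ac: "absolutely_continuous_on {a..b} f" and N: "negligible N" and e: "0 < e"
  obtains U where "open U" "N \<subseteq> U"
    "\<And>q. q tagged_partial_division_of {a..b} \<Longrightarrow> (\<And>x K. (x, K) \<in> q \<Longrightarrow> K \<subseteq> U) \<Longrightarrow>
        (\<Sum>(x, K)\<in>q. norm (f (Sup K) - f (Inf K))) < e"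
proof -
  obtain \<delta> where "\<delta> > 0" and \<delta>: "\<And>d. d division_of \<Union>d \<Longrightarrow> \<Union>d \<subseteq> {a..b} \<Longrightarrow>
      (\<Sum>k\<in>d. measure lborel k) < \<delta> \<Longrightarrow> (\<Sum>k\<in>d. norm (f (Sup k) - f (Inf k))) < e"
    using ac e unfolding absolutely_continuous_on_def by meson
  obtain U where U: "open U" "N \<subseteq> U" "U - N \<in> lmeasurable" "emeasure lebesgue (U - N) < ennreal \<delta>"
    using sets_lebesgue_outer_open[OF negligible_imp_sets[OF N] \<open>\<delta> > 0\<close>] by metis
  have Um: "U \<in> lmeasurable"
    by (metis N U(2,3) Un_Diff_cancel2 fmeasurable.Un negligible_imp_measurable sup.absorb1)
  have mU: "measure lebesgue U < \<delta>"
  proof -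
    have "measure lebesgue U = measure lebesgue (U - N)"
      using N Um by (metis fmeasurableD measure_Diff_null_set negligible_iff_null_sets)
    moreover have "measure lebesgue (U - N) < \<delta>"
      using U(3,4) \<open>\<delta> > 0\<close>
      by (simp add: emeasure_eq_measure2 ennreal_less_iff)
    ultimately show ?thesis by simp
  qed
  show thesis
  proof
    fix q assume q: "q tagged_partial_division_of {a..b}" and qU: "\<And>x K. (x, K) \<in> q \<Longrightarrow> K \<subseteq> U"
    define d where "d = snd ` q"
    have div: "d division_of \<Union>d"
      using partial_division_of_tagged_division[OF q] by (simp add: d_def)
    have "(\<Sum>k\<in>d. measure lborel k) = (\<Sum>k\<in>d. measure lebesgue k)"
    proof (rule sum.cong)
      fix k assume "k \<in> d"
      then obtain u v where "k = cbox u v" using division_ofD(4)[OF div] by blast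
      then show "measure lborel k = measure lebesgue k" by (simp add: measure_completion)
    qed simp
    also have "\<dots> = measure lebesgue (\<Union>d)"
      by (rule content_division[OF div])
    also have "\<dots> \<le> measure lebesgue U"
      using qU Um div
      by (intro measure_mono_fmeasurable) (fastforce simp: d_def lmeasurable_division fmeasurableD)+
    finally have "(\<Sum>k\<in>d. norm (f (Sup k) - f (Inf k))) < e"
      using mU tagged_partial_division_ofD(3)[OF q] by (intro \<delta> div) (fastforce simp: d_def)+
    moreover have "(\<Sum>(x, K)\<in>q. norm (f (Sup K) - f (Inf K))) = (\<Sum>k\<in>d. norm (f (Sup k) - f (Inf k)))"
    proof -
      \<comment> \<open>The values \<open>Sup {}\<close> and \<open>Inf {}\<close> carry no
        information, so the empty set gets the value 0 by hand. Then \<open>g\<close> vanishes on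
        every degenerate interval; only such intervals can carry two different tags, so summing over
        tagged pairs or over intervals gives the same result.\<close>
      define g where "g K = (if K = {} then 0 else norm (f (Sup K) - f (Inf K)))" for K
      have "(\<Sum>(x, K)\<in>q. norm (f (Sup K) - f (Inf K))) = (\<Sum>(x, K)\<in>q. g K)"
        using tagged_partial_division_ofD(2)[OF q] by (intro sum.cong) (fastforce simp: g_def)+
      also have "\<dots> = sum g d"
        unfolding d_def
        by (rule sum.over_tagged_division_lemma[OF tagged_partial_division_of_Union_self[OF q]])
           (auto simp: g_def)
      also have "\<dots> = (\<Sum>k\<in>d. norm (f (Sup k) - f (Inf k)))"
        using div by (intro sum.cong) (auto simp: g_def)
      finally show ?thesis .
    qed
    ultimately show "(\<Sum>(x, K)\<in>q. norm (f (Sup K) - f (Inf K))) < e"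
      by simp
  qed (use U in auto)
qed

text \<open>The linear approximations at \<open>x\<close> are taken for both end points and
  subtracted. Because \<open>x\<close> lies between \<open>u\<close> and \<open>v\<close>, the two
  errors add up to exactly \<open>e\<close> times the length of the interval.\<close>

lemma has_vector_derivative_straddle:
  fixes f :: "real \<Rightarrow> 'a::real_normed_vector"
  assumes "(f has_vector_derivative f') (at x within S)" "0 < e"
  obtains d where "0 < d"
    "\<And>u v. u \<in> S \<Longrightarrow> v \<in> S \<Longrightarrow> u \<le> x \<Longrightarrow> x \<le> v \<Longrightarrow> \<bar>u - x\<bar> < d \<Longrightarrow> \<bar>v - x\<bar> < d \<Longrightarrow>
       norm ((v - u) *\<^sub>R f' - (f v - f u)) \<le> e * (v - u)"
proof -
  obtain d where "d > 0" and d: "\<And>y. y \<in> S \<Longrightarrow> norm (y - x) < d \<Longrightarrow>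
      norm (f y - f x - (y - x) *\<^sub>R f') \<le> e * norm (y - x)"
    using assms unfolding has_vector_derivative_def has_derivative_within_alt by blast
  show thesis
  proof
    fix u v assume uv: "u \<in> S" "v \<in> S" "u \<le> x" "x \<le> v" "\<bar>u - x\<bar> < d" "\<bar>v - x\<bar> < d"
    have "(v - u) *\<^sub>R f' - (f v - f u) = (f u - f x - (u - x) *\<^sub>R f') - (f v - f x - (v - x) *\<^sub>R f')"
      by (simp add: algebra_simps)
    also have "norm \<dots> \<le> norm (f u - f x - (u - x) *\<^sub>R f') + norm (f v - f x - (v - x) *\<^sub>R f')"
      by (rule norm_triangle_ineq4)
    also have "\<dots> \<le> e * norm (u - x) + e * norm (v - x)"
      using uv by (intro add_mono d) auto
    also have "\<dots> = e * (v - u)"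
      using uv by (simp add: algebra_simps)
    finally show "norm ((v - u) *\<^sub>R f' - (f v - f u)) \<le> e * (v - u)" .
  qed fact
qed

text \<open>The error of a Riemann sum splits by tags. Intervals tagged outside \<open>N\<close> are
  handled by differentiability, and those tagged in \<open>N\<close> are forced by the gauge into a
  set over which \<open>f\<close> hardly varies. Each group contributes at most half of the allowed
  error.\<close>

lemma absolutely_continuous_on_has_integral:
  fixes f :: "real \<Rightarrow> 'a::real_normed_vector"
  assumes "a \<le> b" and ac: "absolutely_continuous_on {a..b} f" and N: "negligible N"
    and deriv: "\<And>x. x \<in> {a..b} - N \<Longrightarrow> (f has_vector_derivative f' x) (at x within {a..b})"
  shows "(f' has_integral f b - f a) {a..b}"
proof -
  \<comment> \<open>With the integrand set to 0 on \<open>N\<close>, an interval tagged there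
    contributes only the increment of \<open>f\<close>. Changing values on a null set restores
    \<open>f'\<close> at the end.\<close>
  define g where "g x = (if x \<in> N then 0 else f' x)" for x
  have "(g has_integral f b - f a) {a..b}"
    unfolding has_integral_real
  proof (intro allI impI)
    fix e :: real assume "e > 0"
    \<comment> \<open>The summand 1 keeps the denominator positive when
      \<open>a = b\<close>.\<close>
    define \<epsilon> where "\<epsilon> = e / (2 * (b - a + 1))"
    have "\<epsilon> > 0" using \<open>e > 0\<close> \<open>a \<le> b\<close> by (simp add: \<epsilon>_def)
    have \<epsilon>_le: "\<epsilon> * (b - a) \<le> e / 2"
      using \<open>e > 0\<close> \<open>a \<le> b\<close> by (simp add: \<epsilon>_def field_simps)
    obtain U where U: "open U" "N \<subseteq> U"
      and small: "\<And>q. q tagged_partial_division_of {a..b} \<Longrightarrow> (\<And>x K. (x, K) \<in> q \<Longrightarrow> K \<subseteq> U) \<Longrightarrow>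
        (\<Sum>(x, K)\<in>q. norm (f (Sup K) - f (Inf K))) < e / 2"
      using \<open>e > 0\<close> by (rule absolutely_continuous_on_small_cover[OF ac N half_gt_zero]) blast
    have "\<exists>d>0. x \<in> {a..b} - N \<longrightarrow> (\<forall>u\<in>{a..b}. \<forall>v\<in>{a..b}. u \<le> x \<longrightarrow> x \<le> v \<longrightarrow>
        \<bar>u - x\<bar> < d \<longrightarrow> \<bar>v - x\<bar> < d \<longrightarrow> norm ((v - u) *\<^sub>R f' x - (f v - f u)) \<le> \<epsilon> * (v - u))" for x
    proof (cases "x \<in> {a..b} - N")
      case True
      show ?thesis
        by (rule has_vector_derivative_straddle[OF deriv[OF True] \<open>\<epsilon> > 0\<close>]) blast
    qed (auto intro: exI[of _ 1])
    then obtain d where d0: "\<And>x. d x > 0"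
      and d: "\<And>x u v. x \<in> {a..b} - N \<Longrightarrow> u \<in> {a..b} \<Longrightarrow> v \<in> {a..b} \<Longrightarrow> u \<le> x \<Longrightarrow> x \<le> v \<Longrightarrow>
        \<bar>u - x\<bar> < d x \<Longrightarrow> \<bar>v - x\<bar> < d x \<Longrightarrow> norm ((v - u) *\<^sub>R f' x - (f v - f u)) \<le> \<epsilon> * (v - u)"
      by metis
    define \<gamma> where "\<gamma> x = (if x \<in> N then U else ball x (d x))" for x
    have gauge: "gauge \<gamma>"
      using U d0 by (auto simp: gauge_def \<gamma>_def)
    have main: "norm ((\<Sum>(x, K)\<in>p. measure lborel K *\<^sub>R g x) - (f b - f a)) < e"
      if p: "p tagged_division_of {a..b}" and fine: "\<gamma> fine p" for p
    proof -
      note pD = tagged_division_ofD[OF p]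
      \<comment> \<open>\<open>q\<close> collects the intervals tagged in \<open>N\<close>, and
        \<open>D z\<close> is the error of a single tagged interval. The increments of
        \<open>f\<close> telescope over \<open>p\<close>, so the sum of all \<open>D z\<close> is
        the total error.\<close>
      define q where "q = {z \<in> p. fst z \<in> N}"
      define D where "D z = measure lborel (snd z) *\<^sub>R g (fst z) - (f (Sup (snd z)) - f (Inf (snd z)))" for z
      have q: "q \<subseteq> p" by (auto simp: q_def)
      have K: "norm (D (x, K)) \<le> \<epsilon> * (Sup K - Inf K)" if "(x, K) \<in> p - q" for x K
      proof -
        have xK: "(x, K) \<in> p" "x \<notin> N" using that by (auto simp: q_def)
        obtain u v where uv: "K = {u..v}" using pD(4)[OF xK(1)] by auto
        have x: "u \<le> x" "x \<le> v" using pD(2)[OF xK(1)] uv by auto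
        have "K \<subseteq> ball x (d x)"
          using fineD[OF fine xK(1)] xK(2) by (simp add: \<gamma>_def)
        then have "u \<in> ball x (d x)" "v \<in> ball x (d x)"
          using uv x by (meson atLeastAtMost_iff order_refl order_trans subsetD)+
        moreover have "u \<in> {a..b}" "v \<in> {a..b}" "x \<in> {a..b}" using pD(3)[OF xK(1)] uv x by auto
        ultimately have "norm ((v - u) *\<^sub>R f' x - (f v - f u)) \<le> \<epsilon> * (v - u)"
          using x xK(2) by (intro d) (auto simp: dist_real_def)
        then show ?thesis
          using x uv xK(2) by (simp add: D_def g_def)
      qed
      have "(\<Sum>z\<in>q. norm (D z)) = (\<Sum>(x, K)\<in>q. norm (f (Sup K) - f (Inf K)))"
        by (intro sum.cong) (auto simp: D_def q_def g_def norm_minus_commute)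
      also have "\<dots> < e / 2"
      proof (rule small)
        show "q tagged_partial_division_of {a..b}"
          using p q by (meson tagged_division_of tagged_division_of_def tagged_partial_division_subset)
        show "K' \<subseteq> U" if "(x, K') \<in> q" for x K'
          using that fineD[OF fine, of x K'] by (auto simp: q_def \<gamma>_def)
      qed
      finally have 1: "(\<Sum>z\<in>q. norm (D z)) < e / 2" .
      have "(\<Sum>z\<in>p - q. norm (D z)) \<le> (\<Sum>z\<in>p - q. \<epsilon> * (Sup (snd z) - Inf (snd z)))"
        using K by (intro sum_mono) auto
      \<comment> \<open>Passing to all of \<open>p\<close> adds nonnegative terms and lets the
        lengths telescope to \<open>b - a\<close>.\<close>
      also have "\<dots> \<le> (\<Sum>z\<in>p. \<epsilon> * (Sup (snd z) - Inf (snd z)))"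
      proof (rule sum_mono2)
        fix z assume "z \<in> p - (p - q)"
        then obtain x u v where "z = (x, {u..v})" "x \<in> {u..v}"
          using pD(2,4) by (metis Diff_iff box_real(2) surj_pair)
        then show "0 \<le> \<epsilon> * (Sup (snd z) - Inf (snd z))"
          using \<open>\<epsilon> > 0\<close> by auto
      qed (use pD(1) in auto)
      also have "\<dots> = \<epsilon> * (b - a)"
        using additive_tagged_division_1[OF \<open>a \<le> b\<close> p, of "\<lambda>x. x"]
        by (simp add: case_prod_unfold flip: sum_distrib_left)
      finally have 2: "(\<Sum>z\<in>p - q. norm (D z)) \<le> e / 2" using \<epsilon>_le by simp
      have "(\<Sum>(x, K)\<in>p. measure lborel K *\<^sub>R g x) - (f b - f a) = (\<Sum>z\<in>p. D z)"
        using additive_tagged_division_1[OF \<open>a \<le> b\<close> p, of f]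
        by (simp add: D_def sum_subtractf case_prod_unfold)
      also have "norm \<dots> \<le> (\<Sum>z\<in>p. norm (D z))" by (rule norm_sum)
      also have "\<dots> = (\<Sum>z\<in>p - q. norm (D z)) + (\<Sum>z\<in>q. norm (D z))"
        using pD(1) q by (rule sum.subset_diff[rotated])
      finally show ?thesis using 1 2 by simp
    qed
    show "\<exists>\<gamma>. gauge \<gamma> \<and> (\<forall>\<D>. \<D> tagged_division_of {a..b} \<and> \<gamma> fine \<D> \<longrightarrow>
        norm ((\<Sum>(x, k)\<in>\<D>. measure lborel k *\<^sub>R g x) - (f b - f a)) < e)"
      by (intro exI[of _ \<gamma>] conjI allI impI gauge main) (erule conjunct1, erule conjunct2)
  qed
  then show ?thesis
    by (rule has_integral_spike[OF N, rotated]) (simp add: g_def)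
qed

section \<open>Lebesgue differentiation\<close>

text \<open>The null set depends on \<open>f\<close> alone, and \<open>F\<close> has to be a
  primitive only near \<open>x\<close>. This local form suits functions that are controlled only at
  nonnegative times.\<close>

lemma indefinite_integral_has_vector_derivative_AE:
  fixes f :: "real \<Rightarrow> 'a::euclidean_space"
  assumes f: "\<And>a b. f integrable_on {a..b}"
  obtains N where "negligible N"
    "\<And>F x r. x \<notin> N \<Longrightarrow> 0 < r \<Longrightarrow>
       (\<And>a b. \<bar>a - x\<bar> < r \<Longrightarrow> \<bar>b - x\<bar> < r \<Longrightarrow> a \<le> b \<Longrightarrow> F b - F a = integral {a..b} f) \<Longrightarrow>
       (F has_vector_derivative f x) (at x)"
proof -
  have "\<And>a b. f integrable_on cbox a b" using f by simp
  then obtain N1 where N1: "negligible N1" "\<And>x e. x \<notin> N1 \<Longrightarrow> 0 < e \<Longrightarrow> \<exists>d>0. \<forall>h. 0 < h \<and> h < d \<longrightarrow>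
       norm (integral (cbox x (x + h *\<^sub>R One)) f /\<^sub>R h ^ DIM(real) - f x) < e"
    by (rule integrable_ccontinuous_explicit) blast
  \<comment> \<open>Averages over intervals to the right of \<open>x\<close> give the right
    derivative; the same result for the reflected function gives the left one.\<close>
  have "\<And>a b. (\<lambda>x. f (- x)) integrable_on cbox a b"
  proof -
    fix a b :: real
    show "(\<lambda>x. f (- x)) integrable_on cbox a b"
      using integrable_reflect[where f=f and a="- b" and b="- a"] f[of "- b" "- a"] by simp
  qed
  then obtain N2 where N2: "negligible N2" "\<And>x e. x \<notin> N2 \<Longrightarrow> 0 < e \<Longrightarrow> \<exists>d>0. \<forall>h. 0 < h \<and> h < d \<longrightarrow>
       norm (integral (cbox x (x + h *\<^sub>R One)) (\<lambda>x. f (- x)) /\<^sub>R h ^ DIM(real) - f (- x)) < e"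
    by (rule integrable_ccontinuous_explicit) blast
  show thesis
  proof
    show "negligible (N1 \<union> uminus ` N2)"
      using N1(1) N2(1)
      by (intro negligible_Un negligible_differentiable_image_negligible)
        (auto intro: derivative_intros simp: differentiable_on_def)
  next
    fix F x and r :: real assume x: "x \<notin> N1 \<union> uminus ` N2" and "0 < r"
      and F: "\<And>a b. \<bar>a - x\<bar> < r \<Longrightarrow> \<bar>b - x\<bar> < r \<Longrightarrow> a \<le> b \<Longrightarrow> F b - F a = integral {a..b} f"
    have x': "x \<notin> N1" "- x \<notin> N2" using x by (auto simp: image_iff)
    have "\<exists>d>0. \<forall>y. norm (y - x) < d \<longrightarrow> norm (F y - F x - (y - x) *\<^sub>R f x) \<le> e * norm (y - x)"
      if "0 < e" for e
    proof -
      have "\<exists>d>0. \<forall>h. 0 < h \<and> h < d \<longrightarrow> norm (integral {x..x + h} f /\<^sub>R h - f x) < e"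
        using N1(2)[OF x'(1) \<open>0 < e\<close>] by simp
      then obtain d1 where d1: "d1 > 0"
        "\<And>h. 0 < h \<Longrightarrow> h < d1 \<Longrightarrow> norm (integral {x..x + h} f /\<^sub>R h - f x) < e"
        by blast
      have "\<exists>d>0. \<forall>h. 0 < h \<and> h < d \<longrightarrow>
          norm (integral {- x..- x + h} (\<lambda>x. f (- x)) /\<^sub>R h - f x) < e"
        using N2(2)[OF x'(2) \<open>0 < e\<close>] by simp
      then obtain d2 where d2: "d2 > 0" "\<And>h. 0 < h \<Longrightarrow> h < d2 \<Longrightarrow>
          norm (integral {- x..- x + h} (\<lambda>x. f (- x)) /\<^sub>R h - f x) < e"
        by blast
      have "norm ((F (x + h) - F x) /\<^sub>R h - f x) < e" if h: "h \<noteq> 0" "\<bar>h\<bar> < min r (min d1 d2)" for h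
      proof (cases "h > 0")
        case True
        then show ?thesis using d1(2)[of h] h F[of x "x + h"] by simp
      next
        case False
        then have "h < 0" using h by simp
        then have "norm (integral {- x..- x - h} (\<lambda>x. f (- x)) /\<^sub>R (- h) - f x) < e"
          using d2(2)[of "- h"] h by simp
        moreover have "integral {- x..- x - h} (\<lambda>x. f (- x)) = F x - F (x + h)"
          using Henstock_Kurzweil_Integration.integral_reflect_real[of x "x + h" f] F[of "x + h" x] h \<open>h < 0\<close> by simp
        ultimately show ?thesis
          by (simp add: scaleR_diff_right)
      qed
      note quot = this
      have "norm (F y - F x - (y - x) *\<^sub>R f x) \<le> e * norm (y - x)" if "norm (y - x) < min r (min d1 d2)" for y
      proof (cases "y = x")
        case False
        have "F y - F x - (y - x) *\<^sub>R f x = (y - x) *\<^sub>R ((F (x + (y - x)) - F x) /\<^sub>R (y - x) - f x)"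
          using False by (simp add: scaleR_diff_right)
        also have "norm \<dots> \<le> e * norm (y - x)"
          using quot[of "y - x"] that False
          by (simp add: mult.commute[of e] mult_left_mono)
        finally show ?thesis .
      qed simp
      then show ?thesis
        using d1(1) d2(1) \<open>0 < r\<close> by (intro exI[of _ "min r (min d1 d2)"]) auto
    qed
    then show "(F has_vector_derivative f x) (at x)"
      by (simp add: has_vector_derivative_def has_derivative_within_alt bounded_linear_scaleR_left)
  qed
qed

section \<open>Lipschitz functions and integral estimates\<close>

lemma lipschitz_on_imp_absolutely_continuous_on:
  fixes f :: "real \<Rightarrow> 'a::real_normed_vector"
  assumes lip: "C-lipschitz_on S f"
  shows "absolutely_continuous_on S f"
  unfolding absolutely_continuous_on_def
proof (intro allI impI)
  fix e :: real assume "e > 0"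
  have C: "C \<ge> 0" using lip by (rule lipschitz_on_nonneg)
  show "\<exists>\<delta>>0. \<forall>d. d division_of \<Union>d \<and> \<Union>d \<subseteq> S \<and> (\<Sum>k\<in>d. measure lborel k) < \<delta> \<longrightarrow>
        (\<Sum>k\<in>d. norm (f (Sup k) - f (Inf k))) < e"
  \<comment> \<open>\<open>C + 1\<close> replaces \<open>C\<close> because the Lipschitz constant
    may be 0.\<close>
  proof (intro exI[of _ "e / (C + 1)"] conjI allI impI)
    show "0 < e / (C + 1)" using C \<open>e > 0\<close> by simp
    fix d assume d: "d division_of \<Union>d \<and> \<Union>d \<subseteq> S \<and> (\<Sum>k\<in>d. measure lborel k) < e / (C + 1)"
    have "(\<Sum>k\<in>d. norm (f (Sup k) - f (Inf k))) \<le> (\<Sum>k\<in>d. C * measure lborel k)"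
    proof (rule sum_mono)
      fix k assume k: "k \<in> d"
      then obtain u v where uv: "k = {u..v}" "u \<le> v"
        using d by (metis atLeastatMost_empty_iff box_real(2) division_ofD(3,4))
      then have "u \<in> k" "v \<in> k" by auto
      then have "u \<in> S" "v \<in> S" using d k by blast+
      then show "norm (f (Sup k) - f (Inf k)) \<le> C * measure lborel k"
        using lipschitz_onD[OF lip, of v u] uv by (simp add: dist_norm)
    qed
    also have "\<dots> \<le> (C + 1) * (\<Sum>k\<in>d. measure lborel k)"
      by (simp add: sum_distrib_left[symmetric] mult_right_mono sum_nonneg)
    also have "\<dots> < e"
      using d C by (simp add: field_simps)
    finally show "(\<Sum>k\<in>d. norm (f (Sup k) - f (Inf k))) < e" .
  qed
qed

lemma integral_diff_eq:
  fixes f :: "real \<Rightarrow> 'a::banach"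
  assumes "f integrable_on {0..T}" "0 \<le> s" "s \<le> t" "t \<le> T"
  shows "integral {0..t} f - integral {0..s} f = integral {s..t} f"
proof -
  have "f integrable_on {0..t}"
    using assms by (auto intro: integrable_on_subinterval)
  then show ?thesis
    using Henstock_Kurzweil_Integration.integral_combine[of 0 s t f] assms by (metis add_diff_cancel_left')
qed

text \<open>Integrating a power of the distance to \<open>s\<close> raises the exponent and divides
  by the new one; iteration therefore produces factorials. Writing the integral from
  \<open>s\<close> to \<open>t\<close> as a difference of integrals from 0 covers both orders of
  \<open>s\<close> and \<open>t\<close>.\<close>

lemma norm_integral_diff_le_power:
  fixes f :: "real \<Rightarrow> 'a::banach"
  assumes f: "f integrable_on {0..T}" and st: "s \<in> {0..T}" "t \<in> {0..T}"
    and bound: "\<And>u. u \<in> {0..T} \<Longrightarrow> norm (f u) \<le> c * \<bar>u - s\<bar> ^ k"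
  shows "norm (integral {0..t} f - integral {0..s} f) \<le> c * \<bar>t - s\<bar> ^ Suc k / Suc k"
proof (cases "s \<le> t")
  case True
  have "((\<lambda>u. c * (u - s) ^ k) has_integral c * (t - s) ^ Suc k / Suc k - c * (s - s) ^ Suc k / Suc k) {s..t}"
    using True
    by (intro fundamental_theorem_of_calculus)
       (auto intro!: derivative_eq_intros simp flip: has_real_derivative_iff_has_vector_derivative
             simp del: power_Suc of_nat_Suc)
  then have g: "((\<lambda>u. c * (u - s) ^ k) has_integral c * (t - s) ^ Suc k / Suc k) {s..t}"
    by simp
  have "norm (integral {s..t} f) \<le> integral {s..t} (\<lambda>u. c * (u - s) ^ k)"
  proof (rule integral_norm_bound_integral)
    show "f integrable_on {s..t}" using f st by (auto intro: integrable_on_subinterval)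
    show "norm (f u) \<le> c * (u - s) ^ k" if "u \<in> {s..t}" for u
      using bound[of u] that st by simp
  qed (use g in blast)
  then show ?thesis
    using integral_diff_eq[OF f, of s t] st True integral_unique[OF g] by simp
next
  case False
  then have ts: "t \<le> s" by simp
  have "((\<lambda>u. c * (s - u) ^ k) has_integral - (c * (s - s) ^ Suc k / Suc k) - - (c * (s - t) ^ Suc k / Suc k)) {t..s}"
    using ts
    by (intro fundamental_theorem_of_calculus)
       (auto intro!: derivative_eq_intros simp flip: has_real_derivative_iff_has_vector_derivative
             simp del: power_Suc of_nat_Suc)
  then have g: "((\<lambda>u. c * (s - u) ^ k) has_integral c * (s - t) ^ Suc k / Suc k) {t..s}"
    by simp
  have "norm (integral {t..s} f) \<le> integral {t..s} (\<lambda>u. c * (s - u) ^ k)"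
  proof (rule integral_norm_bound_integral)
    show "f integrable_on {t..s}" using f st by (auto intro: integrable_on_subinterval)
    show "norm (f u) \<le> c * (s - u) ^ k" if "u \<in> {t..s}" for u
      using bound[of u] that st by simp
  qed (use g in blast)
  then show ?thesis
    using integral_diff_eq[OF f, of t s] st ts integral_unique[OF g]
    by (simp add: norm_minus_commute[of "integral {0..t} f"])
qed

section \<open>Linear equations with measurable coefficients\<close>

text \<open>The product \<open>p\<close> stays abstract so that one theory serves both
  \<open>*v\<close>, for solutions, and \<open>**\<close>, for the matrix equation behind the
  transition matrix.\<close>

locale linear_equation =
  fixes p :: "'b::euclidean_space \<Rightarrow> 'a::euclidean_space \<Rightarrow> 'a" and A :: "real \<Rightarrow> 'b"
  assumes bilinear: "bounded_bilinear p"
    and measurable: "A \<in> borel_measurable (lebesgue_on {0..})"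
    and locally_bounded: "0 \<le> T \<Longrightarrow> bounded (A ` {0..T})"
begin

sublocale bounded_bilinear p by (rule bilinear)

lemma field_bound:
  assumes "0 \<le> T"
  obtains L where "0 < L" "\<And>u y. u \<in> {0..T} \<Longrightarrow> norm (p (A u) y) \<le> L * norm y"
proof -
  obtain K where K: "0 < K" "\<And>a b. norm (p a b) \<le> norm a * norm b * K"
    using pos_bounded by blast
  obtain B where B: "0 < B" "\<And>u. u \<in> {0..T} \<Longrightarrow> norm (A u) \<le> B"
    using locally_bounded[OF assms] unfolding bounded_pos by auto
  show thesis
  proof
    show "norm (p (A u) y) \<le> B * K * norm y" if "u \<in> {0..T}" for u y
    proof (rule order_trans[OF K(2)])
      show "norm (A u) * norm y * K \<le> B * K * norm y"
        using mult_right_mono[OF B(2)[OF that], of "norm y * K"] K(1)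
        by (simp add: mult.assoc mult.left_commute mult.commute)
    qed
  qed (use K B in simp)
qed

lemma field_integrable:
  assumes x: "continuous_on {0..T} x"
  shows "(\<lambda>u. p (A u) (x u)) integrable_on {0..T}"
proof (cases "0 \<le> T")
  case True
  obtain L where L: "0 < L" "\<And>u y. u \<in> {0..T} \<Longrightarrow> norm (p (A u) y) \<le> L * norm y"
    using field_bound[OF True] by blast
  have mA: "A \<in> borel_measurable (lebesgue_on {0..T})"
    by (rule measurable_restrict_mono[OF measurable]) auto
  have mx: "x \<in> borel_measurable (lebesgue_on {0..T})"
    by (rule continuous_imp_measurable_on_sets_lebesgue[OF x]) auto
  show ?thesis
  proof (rule measurable_bounded_by_integrable_imp_integrable)
    show "(\<lambda>u. p (A u) (x u)) \<in> borel_measurable (lebesgue_on {0..T})"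
      using mA mx
      by (rule borel_measurable_continuous_Pair) (intro continuous_on continuous_intros)
    show "(\<lambda>u. L * norm (x u)) integrable_on {0..T}"
      by (intro integrable_continuous_real continuous_intros x)
  qed (use L in auto)
qed (simp add: integrable_on_empty)

abbreviation solution :: "(real \<Rightarrow> 'a) \<Rightarrow> bool" where
  "solution x \<equiv> caratheodory_solution (\<lambda>u y. p (A u) y) x"

section \<open>Equivalence with the integral equation\<close>

lemma solution_has_integral:
  assumes x: "solution x" and "0 \<le> t"
  shows "((\<lambda>u. p (A u) (x u)) has_integral x t - x 0) {0..t}"
proof -
  have ac: "absolutely_continuous_on {0..t} x"
    and "AE u in lborel. 0 \<le> u \<longrightarrow> (x has_vector_derivative p (A u) (x u)) (at u within {0..})"
    using x \<open>0 \<le> t\<close> by (auto simp: caratheodory_solution_def)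
  \<comment> \<open>Negligible sets are the null sets of the completed measure, hence the passage
    from \<open>lborel\<close> to \<open>lebesgue\<close>.\<close>
  then have "AE u in lebesgue. 0 \<le> u \<longrightarrow> (x has_vector_derivative p (A u) (x u)) (at u within {0..})"
    by (simp add: AE_completion)
  then obtain N where N: "negligible N"
    "{u. \<not> (0 \<le> u \<longrightarrow> (x has_vector_derivative p (A u) (x u)) (at u within {0..}))} \<subseteq> N"
    unfolding eventually_ae_filter_negligible by blast
  show ?thesis
  proof (rule absolutely_continuous_on_has_integral[OF \<open>0 \<le> t\<close> ac N(1)])
    fix u assume "u \<in> {0..t} - N"
    then have "(x has_vector_derivative p (A u) (x u)) (at u within {0..})" using N(2) by auto
    then show "(x has_vector_derivative p (A u) (x u)) (at u within {0..t})"
      by (rule has_vector_derivative_within_subset) auto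
  qed
qed

lemma has_integral_continuous_on:
  assumes x: "\<And>t. 0 \<le> t \<Longrightarrow> ((\<lambda>u. p (A u) (x u)) has_integral x t - x 0) {0..t}"
  shows "continuous_on {0..T} x"
proof (cases "0 \<le> T")
  case True
  have "continuous_on {0..T} (\<lambda>t. x 0 + integral {0..t} (\<lambda>u. p (A u) (x u)))"
    using x[OF True] by (intro continuous_intros indefinite_integral_continuous_1) blast
  moreover have "x 0 + integral {0..t} (\<lambda>u. p (A u) (x u)) = x t" if "t \<in> {0..T}" for t
    using integral_unique[OF x, of t] that by simp
  ultimately show ?thesis by (rule continuous_on_eq)
qed simp

text \<open>On a compact interval the integrand is bounded, so \<open>x\<close> is Lipschitz there
  and hence absolutely continuous. The equation almost everywhere is Lebesgue differentiation of the
  indefinite integral.\<close>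

lemma has_integral_imp_solution:
  assumes x: "\<And>t. 0 \<le> t \<Longrightarrow> ((\<lambda>u. p (A u) (x u)) has_integral x t - x 0) {0..t}"
  shows "solution x"
proof -
  define g where "g u = p (A u) (x u)" for u
  have g: "g integrable_on {0..T}" for T
    using field_integrable[OF has_integral_continuous_on[OF x]] by (simp add: g_def[abs_def])
  have xg: "x b - x a = integral {a..b} g" if "0 \<le> a" "a \<le> b" for a b
  proof -
    have "x b - x a = integral {0..b} g - integral {0..a} g"
      using integral_unique[OF x, of a] integral_unique[OF x, of b] that by (simp add: g_def[abs_def])
    also have "\<dots> = integral {a..b} g" using that by (intro integral_diff_eq[OF g[of b]]) auto
    finally show ?thesis .
  qed
  have "absolutely_continuous_on {0..T} x" if "0 \<le> T" for T
  proof -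
    obtain L where L: "0 < L" "\<And>u y. u \<in> {0..T} \<Longrightarrow> norm (p (A u) y) \<le> L * norm y"
      using field_bound[OF \<open>0 \<le> T\<close>] by blast
    obtain B where B: "0 < B" "\<And>u. u \<in> {0..T} \<Longrightarrow> norm (x u) \<le> B"
      using compact_imp_bounded[OF compact_continuous_image[OF has_integral_continuous_on[OF x] compact_Icc[of 0 T]]]
      unfolding bounded_pos by auto
    have gB: "norm (g u) \<le> L * B" if "u \<in> {0..T}" for u
      unfolding g_def by (rule order_trans[OF L(2)[OF that]]) (use B(2)[OF that] L(1) in simp)
    have "(L * B)-lipschitz_on {0..T} x"
    proof (rule lipschitz_onI)
      fix u v assume uv: "u \<in> {0..T}" "v \<in> {0..T}"
      have "dist (x u) (x v) = norm (integral {0..v} g - integral {0..u} g)"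
        using integral_unique[OF x, of u] integral_unique[OF x, of v] uv
        by (simp add: g_def[abs_def] dist_norm norm_minus_commute)
      also have "\<dots> \<le> L * B * \<bar>v - u\<bar> ^ Suc 0 / Suc 0"
        using gB by (intro norm_integral_diff_le_power[OF g uv]) simp
      finally show "dist (x u) (x v) \<le> L * B * dist u v"
        by (simp add: dist_norm abs_minus_commute)
    qed (use L(1) B(1) in simp)
    then show ?thesis by (rule lipschitz_on_imp_absolutely_continuous_on)
  qed
  moreover have "AE t in lborel. 0 \<le> t \<longrightarrow> (x has_vector_derivative g t) (at t within {0..})"
  proof -
    \<comment> \<open>The extension by 0 is integrable on every compact interval of the line, as the
      differentiation result demands.\<close>
    define h where "h u = (if u \<in> {0..} then g u else 0)" for u
    have h: "h integrable_on {a..b}" for a b :: real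
    proof -
      have "g integrable_on {max 0 a..b}"
        using g[of b] by (rule integrable_on_subinterval) auto
      moreover have "{max 0 a..b} = {0..} \<inter> {a..b}" by auto
      ultimately show ?thesis
        unfolding h_def[abs_def] by (simp only: integrable_restrict_Int)
    qed
    obtain N where N: "negligible N" "\<And>F u r. u \<notin> N \<Longrightarrow> 0 < r \<Longrightarrow>
       (\<And>a b. \<bar>a - u\<bar> < r \<Longrightarrow> \<bar>b - u\<bar> < r \<Longrightarrow> a \<le> b \<Longrightarrow> F b - F a = integral {a..b} h) \<Longrightarrow>
       (F has_vector_derivative h u) (at u)"
      using indefinite_integral_has_vector_derivative_AE[OF h] by blast
    \<comment> \<open>Around \<open>t > 0\<close> the radius \<open>t\<close> keeps the interval
      within positive times, where \<open>h\<close> and \<open>g\<close> agree. The point 0 has no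
      such neighbourhood and joins the null set.\<close>
    have "(x has_vector_derivative g t) (at t within {0..})" if t: "t \<notin> insert 0 N" "0 \<le> t" for t
    proof -
      have "(x has_vector_derivative h t) (at t)"
      proof (rule N(2))
        fix a b assume ab: "\<bar>a - t\<bar> < t" "\<bar>b - t\<bar> < t" "a \<le> b"
        have "integral {a..b} h = integral {a..b} g"
          using ab by (intro integral_cong) (auto simp: h_def)
        then show "x b - x a = integral {a..b} h" using xg[of a b] ab by simp
      qed (use t in auto)
      then show ?thesis
        using t by (simp add: h_def has_vector_derivative_at_within)
    qed
    then have "AE t in lebesgue. 0 \<le> t \<longrightarrow> (x has_vector_derivative g t) (at t within {0..})"
      unfolding eventually_ae_filter_negligible using N(1) by (intro exI[of _ "insert 0 N"]) auto
    then show ?thesis by (simp add: AE_completion_iff)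
  qed
  ultimately show ?thesis by (simp add: caratheodory_solution_def g_def)
qed

section \<open>Uniqueness and existence by Picard iteration\<close>

text \<open>The common estimate behind uniqueness and the convergence of the Picard iteration.\<close>

lemma picard_step_bound:
  assumes y: "continuous_on {0..T} y" and st: "s \<in> {0..T}" "t \<in> {0..T}"
    and L: "0 < L" "\<And>u z. u \<in> {0..T} \<Longrightarrow> norm (p (A u) z) \<le> L * norm z"
    and bound: "\<And>u. u \<in> {0..T} \<Longrightarrow> norm (y u) \<le> M * ((L * \<bar>u - s\<bar>) ^ k / fact k)"
  shows "norm (integral {0..t} (\<lambda>u. p (A u) (y u)) - integral {0..s} (\<lambda>u. p (A u) (y u)))
    \<le> M * ((L * \<bar>t - s\<bar>) ^ Suc k / fact (Suc k))"
proof -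
  \<comment> \<open>One factor \<open>L\<close> comes from the field, the other \<open>k\<close>
    from the assumed bound. Integration supplies the division by \<open>Suc k\<close> that completes
    the factorial.\<close>
  define c where "c = M * L ^ Suc k / fact k"
  have "norm (p (A u) (y u)) \<le> c * \<bar>u - s\<bar> ^ k" if "u \<in> {0..T}" for u
  proof -
    have "norm (p (A u) (y u)) \<le> L * norm (y u)" by (rule L(2)[OF that])
    also have "\<dots> \<le> L * (M * ((L * \<bar>u - s\<bar>) ^ k / fact k))"
      using bound[OF that] L(1) by (intro mult_left_mono) auto
    also have "\<dots> = c * \<bar>u - s\<bar> ^ k"
      by (simp add: c_def power_mult_distrib)
    finally show ?thesis .
  qed
  from norm_integral_diff_le_power[OF field_integrable[OF y] st this]
  show ?thesis by (simp add: c_def power_mult_distrib field_simps)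
qed

text \<open>The difference \<open>z\<close> of the two solutions vanishes at \<open>s\<close>, so it
  is a fixed point of the integral operator. Applying the step estimate \<open>k\<close> times
  bounds it by a multiple of the \<open>k\<close>-th term of an exponential series, which tends to
  0.\<close>

lemma solution_unique:
  assumes x: "solution x" and y: "solution y" and eq: "x s = y s" and "0 \<le> s" "0 \<le> t"
  shows "x t = y t"
proof -
  define z where "z u = x u - y u" for u
  define T where "T = max s t"
  have T: "s \<in> {0..T}" "t \<in> {0..T}" "0 \<le> T" using assms by (auto simp: T_def)
  have z: "((\<lambda>u. p (A u) (z u)) has_integral z t - z 0) {0..t}" if "0 \<le> t" for t
    using has_integral_diff[OF solution_has_integral[OF x that] solution_has_integral[OF y that]]
    by (simp add: z_def diff_right algebra_simps)
  have cz: "continuous_on {0..T} z"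
    using z by (rule has_integral_continuous_on)
  have zt: "z t = integral {0..t} (\<lambda>u. p (A u) (z u)) - integral {0..s} (\<lambda>u. p (A u) (z u))"
    if "t \<in> {0..T}" for t
    using integral_unique[OF z, of t] integral_unique[OF z, of s] that T eq by (simp add: z_def)
  obtain L where L: "0 < L" "\<And>u y. u \<in> {0..T} \<Longrightarrow> norm (p (A u) y) \<le> L * norm y"
    using field_bound[OF T(3)] by blast
  obtain M where M: "\<And>u. u \<in> {0..T} \<Longrightarrow> norm (z u) \<le> M"
    using compact_imp_bounded[OF compact_continuous_image[OF cz compact_Icc]]
    unfolding bounded_iff by (metis image_eqI)
  have bound: "norm (z u) \<le> M * ((L * \<bar>u - s\<bar>) ^ k / fact k)" if "u \<in> {0..T}" for u k
    using that
  proof (induction k arbitrary: u)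
    case (Suc k)
    show ?case
      unfolding zt[OF Suc.prems] by (rule picard_step_bound[OF cz T(1) Suc.prems L Suc.IH])
  qed (use M in simp)
  have "(\<lambda>k. (L * \<bar>t - s\<bar>) ^ k / fact k) \<longlonglongrightarrow> 0"
    using summable_LIMSEQ_zero[OF summable_exp[of "L * \<bar>t - s\<bar>"]] by (simp add: field_simps)
  then have "(\<lambda>k. M * ((L * \<bar>t - s\<bar>) ^ k / fact k)) \<longlonglongrightarrow> 0"
    by (rule tendsto_mult_right_zero)
  then have "norm (z t) \<le> 0"
    by (rule LIMSEQ_le_const) (use bound[OF T(2)] in blast)
  then show ?thesis by (simp add: z_def)
qed

text \<open>The solution is the sum of the iterated integrals of the constant \<open>v\<close>,
  whose norms are dominated by an exponential series.\<close>

lemma solution_exists: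
  assumes "0 \<le> s"
  obtains x where "solution x" "x s = v"
proof -
  define I where "I y t = integral {0..t} (\<lambda>u. p (A u) (y u)) - integral {0..s} (\<lambda>u. p (A u) (y u))" for y t
  define Y where "Y = rec_nat (\<lambda>_. v) (\<lambda>_. I)"
  have Y: "Y 0 = (\<lambda>_. v)" "Y (Suc k) = I (Y k)" for k
    by (simp_all add: Y_def)
  have cI: "continuous_on {0..T} (I y)" if "continuous_on {0..T} y" for y T
    unfolding I_def[abs_def]
    by (intro continuous_intros indefinite_integral_continuous_1 field_integrable that)
  have cY: "continuous_on {0..T} (Y k)" for T k
    by (induction k) (auto simp: Y cI)
  define S where "S n t = (\<Sum>k<n. Y k t)" for n t
  define X where "X t = (\<Sum>k. Y k t)" for t
  \<comment> \<open>By linearity of \<open>I\<close>, the partial sums are the Picard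
    iterates.\<close>
  have S_Suc: "S (Suc n) t = v + I (S n) t" if "0 \<le> t" for n t
  proof -
    have "I (S n) t = (\<Sum>k<n. I (Y k) t)"
      unfolding I_def S_def
      by (simp add: sum_right integral_sum field_integrable cY sum_subtractf)
    then show ?thesis
      unfolding S_def by (subst sum.lessThan_Suc_shift) (simp add: Y)
  qed
  \<comment> \<open>The base point must lie in \<open>{0..T}\<close> for the step estimate; shorter
    intervals are reached later by restriction from \<open>max s T\<close>.\<close>
  have lim: "uniform_limit {0..T} S X sequentially" if "s \<le> T" for T
  proof -
    have sT: "s \<in> {0..T}" "0 \<le> T" using that \<open>0 \<le> s\<close> by auto
    obtain L where L: "0 < L" "\<And>u y. u \<in> {0..T} \<Longrightarrow> norm (p (A u) y) \<le> L * norm y"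
      using field_bound[OF sT(2)] by blast
    have bound: "norm (Y k u) \<le> norm v * ((L * \<bar>u - s\<bar>) ^ k / fact k)" if "u \<in> {0..T}" for u k
      using that
    proof (induction k arbitrary: u)
      case (Suc k)
      show ?case
        unfolding Y I_def by (rule picard_step_bound[OF cY sT(1) Suc.prems L Suc.IH])
    qed (simp add: Y)
    show ?thesis
      unfolding S_def[abs_def] X_def[abs_def]
    proof (rule Weierstrass_m_test)
      show "norm (Y k u) \<le> norm v * ((L * T) ^ k / fact k)" if u: "u \<in> {0..T}" for k u
      proof (rule order_trans[OF bound[OF u]])
        have "L * \<bar>u - s\<bar> \<le> L * T" using u sT L(1) by auto
        then show "norm v * ((L * \<bar>u - s\<bar>) ^ k / fact k) \<le> norm v * ((L * T) ^ k / fact k)"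
          using L(1) by (intro mult_left_mono divide_right_mono power_mono) auto
      qed
      show "summable (\<lambda>k. norm v * ((L * T) ^ k / fact k))"
        using summable_exp[of "L * T"] by (intro summable_mult) (simp add: field_simps)
    qed
  qed
  have cX: "continuous_on {0..T} X" for T
  proof -
    have "continuous_on {0..max s T} X"
      by (rule uniform_limit_theorem[OF _ lim])
        (auto simp: S_def[abs_def] intro!: always_eventually continuous_on_sum cY)
    then show ?thesis by (rule continuous_on_subset) auto
  qed
  have X: "X t = v + I X t" if "0 \<le> t" for t
  proof -
    define T where "T = max s t"
    have T: "s \<in> {0..T}" "t \<in> {0..T}" "s \<le> T" "0 \<le> T" using that \<open>0 \<le> s\<close> by (auto simp: T_def)
    obtain L where L: "0 < L" "\<And>u y. u \<in> {0..T} \<Longrightarrow> norm (p (A u) y) \<le> L * norm y"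
      using field_bound[OF T(4)] by blast
    have cS: "continuous_on {0..T} (S n)" for n
      unfolding S_def[abs_def] by (intro continuous_intros cY)
    have "(\<lambda>n. I (S n) t) \<longlonglongrightarrow> I X t"
    proof (rule LIMSEQ_I)
      fix e :: real assume "e > 0"
      \<comment> \<open>The added 1 avoids division by 0 when \<open>t = s\<close> and makes the
        final inequality strict.\<close>
      define d where "d = e / (L * \<bar>t - s\<bar> + 1)"
      have pos: "L * \<bar>t - s\<bar> + 1 > 0" using L(1) by (simp add: add_nonneg_pos)
      then have "d > 0" using \<open>e > 0\<close> by (simp add: d_def)
      then obtain n0 where n0: "\<And>n u. n \<ge> n0 \<Longrightarrow> u \<in> {0..T} \<Longrightarrow> dist (S n u) (X u) < d"
        using uniform_limitD[OF lim[OF T(3)]] unfolding eventually_sequentially by blast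
      have "norm (I (S n) t - I X t) < e" if "n \<ge> n0" for n
      proof -
        have int: "(\<lambda>u. p (A u) (S n u)) integrable_on {0..r}" "(\<lambda>u. p (A u) (X u)) integrable_on {0..r}"
          if "r \<in> {0..T}" for r
          by (rule field_integrable, rule continuous_on_subset[OF cS], use that in auto)
             (rule field_integrable[OF cX])
        \<comment> \<open>This is the step estimate with \<open>k = 0\<close>, fed with the uniform
          distance \<open>d\<close> between \<open>S n\<close> and \<open>X\<close>.\<close>
        have "norm (I (\<lambda>u. S n u - X u) t) \<le> d * ((L * \<bar>t - s\<bar>) ^ Suc 0 / fact (Suc 0))"
          unfolding I_def
          using n0[OF that]
          by (intro picard_step_bound[OF _ T(1,2) L] continuous_intros cS cX) (auto simp: dist_norm less_imp_le)
        also have "\<dots> < d * (L * \<bar>t - s\<bar> + 1)" using \<open>d > 0\<close> by simp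
        also have "\<dots> = e" using pos by (simp add: d_def)
        also have "I (\<lambda>u. S n u - X u) t = I (S n) t - I X t"
          unfolding I_def using int T
          by (simp add: diff_right Henstock_Kurzweil_Integration.integral_diff)
        finally show ?thesis .
      qed
      then show "\<exists>n0. \<forall>n\<ge>n0. norm (I (S n) t - I X t) < e" by blast
    qed
    then have "(\<lambda>n. S (Suc n) t) \<longlonglongrightarrow> v + I X t"
      unfolding S_Suc[OF that] by (intro tendsto_intros)
    moreover have "(\<lambda>n. S (Suc n) t) \<longlonglongrightarrow> X t"
      using tendsto_uniform_limitI[OF lim[OF T(3)] T(2)] by (rule LIMSEQ_Suc)
    ultimately show ?thesis by (rule LIMSEQ_unique[rotated])
  qed
  show thesis
  proof
    show "X s = v" using X[OF \<open>0 \<le> s\<close>] by (simp add: I_def)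
    show "solution X"
    proof (rule has_integral_imp_solution)
      fix t :: real assume "0 \<le> t"
      have "X t - X 0 = integral {0..t} (\<lambda>u. p (A u) (X u))"
        using X[OF \<open>0 \<le> t\<close>] X[of 0] by (simp add: I_def)
      then show "((\<lambda>u. p (A u) (X u)) has_integral X t - X 0) {0..t}"
        using field_integrable[OF cX] by (simp add: integrable_integral)
    qed
  qed
qed

end

section \<open>The transition matrix\<close>

lemma linear_equation_matrix_vector:
  fixes A :: "real \<Rightarrow> real^'n^'n"
  assumes "A \<in> borel_measurable (lebesgue_on {0..})" "\<And>T. 0 \<le> T \<Longrightarrow> bounded (A ` {0..T})"
  shows "linear_equation ((*v) :: _ \<Rightarrow> real^'n \<Rightarrow> _) A"
proof (rule linear_equation.intro)
  show "bounded_bilinear ((*v) :: real^'n^'n \<Rightarrow> real^'n \<Rightarrow> _)"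
    unfolding bilinear_conv_bounded_bilinear[symmetric] bilinear_def
    by (auto intro!: linearI simp: matrix_vector_mult_add_rdistrib matrix_vector_right_distrib
        scaleR_matrix_vector_assoc matrix_vector_mult_scaleR)
qed (use assms in auto)

lemma linear_equation_matrix_matrix:
  fixes A :: "real \<Rightarrow> real^'n^'n"
  assumes "A \<in> borel_measurable (lebesgue_on {0..})" "\<And>T. 0 \<le> T \<Longrightarrow> bounded (A ` {0..T})"
  shows "linear_equation ((**) :: _ \<Rightarrow> real^'n^'n \<Rightarrow> _) A"
proof (rule linear_equation.intro)
  show "bounded_bilinear ((**) :: real^'n^'n \<Rightarrow> real^'n^'n \<Rightarrow> _)"
    unfolding bilinear_conv_bounded_bilinear[symmetric] bilinear_def
    by (auto intro!: linearI simp: matrix_add_ldistrib scalar_matrix_assoc matrix_scalar_ac)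
       (simp add: vec_eq_iff matrix_matrix_mult_def sum.distrib distrib_right)
qed (use assms in auto)

text \<open>If \<open>X\<close> solves the matrix equation with \<open>X s = mat 1\<close>, then
  \<open>X\<close> applied to the fixed vector \<open>x s\<close> solves the vector equation and
  agrees with \<open>x\<close> at \<open>s\<close>. Uniqueness identifies the two.\<close>

lemma solution_eq_transition_matrix:
  fixes A :: "real \<Rightarrow> real^'n^'n"
  assumes A: "A \<in> borel_measurable (lebesgue_on {0..})" "\<And>T. 0 \<le> T \<Longrightarrow> bounded (A ` {0..T})"
    and x: "caratheodory_solution (\<lambda>u y. A u *v y) x" and "0 \<le> s" "0 \<le> t"
  shows "x t = transition_matrix A t s *v x s"
proof -
  interpret V: linear_equation "(*v) :: _ \<Rightarrow> real^'n \<Rightarrow> _" A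
    by (rule linear_equation_matrix_vector[OF A])
  interpret M: linear_equation "(**) :: _ \<Rightarrow> real^'n^'n \<Rightarrow> _" A
    by (rule linear_equation_matrix_matrix[OF A])
  obtain X where X: "M.solution X" "X s = mat 1"
    by (rule M.solution_exists[OF \<open>0 \<le> s\<close>])
  \<comment> \<open>Uniqueness for the matrix equation is what makes the definite description denote
    \<open>X t\<close>.\<close>
  have "transition_matrix A t s = X t"
    unfolding transition_matrix_def
  proof (rule the_equality)
    show "N = X t" if "\<exists>Y. M.solution Y \<and> Y s = mat 1 \<and> Y t = N" for N
      using that M.solution_unique[OF X(1) _ _ \<open>0 \<le> s\<close> \<open>0 \<le> t\<close>] X(2) by metis
  qed (use X in blast)
  moreover have "V.solution (\<lambda>u. X u *v x s)"
  \<comment> \<open>In integral form it suffices to apply the bounded linear map that multiplies a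
    matrix by \<open>x s\<close>.\<close>
  proof (rule V.has_integral_imp_solution)
    fix t :: real assume "0 \<le> t"
    from has_integral_linear[OF M.solution_has_integral[OF X(1) this] V.bounded_linear_left[of "x s"]]
    show "((\<lambda>u. A u *v (X u *v x s)) has_integral X t *v x s - X 0 *v x s) {0..t}"
      by (simp add: o_def matrix_vector_mul_assoc V.diff_left)
  qed
  then have "x t = X t *v x s"
    using V.solution_unique[OF x _ _ \<open>0 \<le> s\<close> \<open>0 \<le> t\<close>] X(2) by simp
  ultimately show ?thesis by simp
qed

section \<open>Growth bounds and the equivalence\<close>

lemma norm_solution_le_power:
  fixes x :: "real \<Rightarrow> 'a::real_normed_vector"
  assumes C: "1 \<le> C"
    and step: "\<And>s t. 0 \<le> s \<Longrightarrow> 0 \<le> t \<Longrightarrow> \<bar>t - s\<bar> \<le> 1 \<Longrightarrow> norm (x t) \<le> C * norm (x s)"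
  shows "0 \<le> s \<Longrightarrow> 0 \<le> t \<Longrightarrow> \<bar>t - s\<bar> \<le> real n \<Longrightarrow> norm (x t) \<le> C ^ n * norm (x s)"
proof (induction n arbitrary: t)
  case (Suc n)
  \<comment> \<open>One unit step from \<open>t\<close> towards \<open>s\<close>, stopping at
    \<open>s\<close>. The point lies between the two times, so it stays nonnegative in either
    direction.\<close>
  define r where "r = (if s \<le> t then max s (t - 1) else min s (t + 1))"
  have r: "0 \<le> r" "\<bar>t - r\<bar> \<le> 1" "\<bar>r - s\<bar> \<le> real n"
    using Suc.prems by (auto simp: r_def)
  have "norm (x t) \<le> C * norm (x r)" using Suc.prems r by (intro step) auto
  also have "\<dots> \<le> C * (C ^ n * norm (x s))"
    using C Suc.IH[of r] r Suc.prems by (intro mult_left_mono) auto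
  finally show ?case by simp
qed simp

text \<open>The equivalences follow from the cycle: exponential bound, Kalman's condition, uniform
  growth bound on windows of width \<open>h\<close>, and back to the exponential bound.\<close>

theorem lemma1:
  fixes A :: "real \<Rightarrow> real^'n^'n"
  assumes "A \<in> borel_measurable (lebesgue_on {0..})"
    and "\<And>T. T \<ge> 0 \<Longrightarrow> bounded (A ` {0..T})"
  shows "((\<exists>K>1. \<exists>\<beta>>0. \<forall>t\<ge>0. \<forall>s\<ge>0.
             onorm ((*v) (transition_matrix A t s)) \<le> K * exp (\<beta> * \<bar>t - s\<bar>))
            \<longleftrightarrow> kalman_condition A)
         \<and> (kalman_condition A
            \<longleftrightarrow> (\<forall>h>0. \<exists>C>1. \<forall>x. caratheodory_solution (\<lambda>u y. A u *v y) x \<longrightarrow>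
                 (\<forall>s\<ge>0. \<forall>t\<in>{s - h..s + h}. t \<ge> 0 \<longrightarrow> norm (x t) \<le> C * norm (x s))))"
    (is "(?i \<longleftrightarrow> _) \<and> (_ \<longleftrightarrow> ?iii)")
proof -
  interpret linear_equation "(*v) :: _ \<Rightarrow> real^'n \<Rightarrow> _" A
    using assms by (rule linear_equation_matrix_vector)
  have transition: "x t = transition_matrix A t s *v x s" if "solution x" "0 \<le> s" "0 \<le> t" for x s t
    using assms that by (rule solution_eq_transition_matrix)
  have "kalman_condition A" if ?i
  proof -
    obtain K \<beta> where K: "K > 1" "\<beta> > 0"
      "\<And>t s. t \<ge> 0 \<Longrightarrow> s \<ge> 0 \<Longrightarrow> onorm ((*v) (transition_matrix A t s)) \<le> K * exp (\<beta> * \<bar>t - s\<bar>)"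
      using \<open>?i\<close> by blast
    have "maps_bounded_sets_on {0..} (\<lambda>r. K * exp (\<beta> * r))"
      unfolding maps_bounded_sets_on_def
    proof (intro allI impI)
      fix S :: "real set" assume "S \<subseteq> {0..}" "bounded S"
      then obtain B where B: "\<And>r. r \<in> S \<Longrightarrow> \<bar>r\<bar> \<le> B" by (auto simp: bounded_iff)
      have "norm (K * exp (\<beta> * r)) \<le> K * exp (\<beta> * B)" if "r \<in> S" for r
        using B[OF that] K by (simp add: abs_mult)
      then show "bounded ((\<lambda>r. K * exp (\<beta> * r)) ` S)"
        unfolding bounded_iff by blast
    qed
    then show ?thesis
      unfolding kalman_condition_def using K by (intro exI[of _ "\<lambda>r. K * exp (\<beta> * r)"]) simp
  qed
  moreover have ?iii if "kalman_condition A"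
  proof (intro allI impI)
    fix h :: real assume "h > 0"
    obtain \<alpha> where \<alpha>: "maps_bounded_sets_on {0..} \<alpha>"
      "\<And>t s. t \<ge> 0 \<Longrightarrow> s \<ge> 0 \<Longrightarrow> onorm ((*v) (transition_matrix A t s)) \<le> \<alpha> \<bar>t - s\<bar>"
      using \<open>kalman_condition A\<close> unfolding kalman_condition_def by blast
    have "bounded (\<alpha> ` {0..h})"
      using \<alpha>(1) bounded_closed_interval unfolding maps_bounded_sets_on_def by simp
    then obtain B where B: "\<And>r. r \<in> {0..h} \<Longrightarrow> \<bar>\<alpha> r\<bar> \<le> B"
      unfolding bounded_iff by (metis image_eqI real_norm_def)
    show "\<exists>C>1. \<forall>x. solution x \<longrightarrow>
        (\<forall>s\<ge>0. \<forall>t\<in>{s - h..s + h}. t \<ge> 0 \<longrightarrow> norm (x t) \<le> C * norm (x s))"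
    \<comment> \<open>The 2 ensures that the constant exceeds 1, whatever the bound \<open>B\<close>
      of \<alpha> on \<open>{0..h}\<close> is.\<close>
    proof (intro exI[of _ "max 2 B"] conjI allI impI ballI)
      fix x s t assume x: "solution x" and st: "0 \<le> s" "t \<in> {s - h..s + h}" "0 \<le> t"
      have "norm (x t) = norm (transition_matrix A t s *v x s)"
        using transition[OF x st(1,3)] by simp
      also have "\<dots> \<le> onorm ((*v) (transition_matrix A t s)) * norm (x s)"
        by (rule onorm) simp
      also have "\<dots> \<le> max 2 B * norm (x s)"
      proof (rule mult_right_mono)
        show "onorm ((*v) (transition_matrix A t s)) \<le> max 2 B"
          using \<alpha>(2)[of t s] B[of "\<bar>t - s\<bar>"] st by force
      qed simp
      finally show "norm (x t) \<le> max 2 B * norm (x s)" .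
    qed simp
  qed
  moreover have ?i if ?iii
  proof -
    obtain C where C: "C > 1" "\<And>x s t. solution x \<Longrightarrow> 0 \<le> s \<Longrightarrow> t \<in> {s - 1..s + 1} \<Longrightarrow>
        0 \<le> t \<Longrightarrow> norm (x t) \<le> C * norm (x s)"
      using \<open>?iii\<close>[rule_format, of 1] by auto
    \<comment> \<open>The window \<open>h = 1\<close> yields both constants: \<open>K = C\<close>
      and \<beta> \<open>= ln C\<close>, which is positive because \<open>C > 1\<close>.\<close>
    have "onorm ((*v) (transition_matrix A t s)) \<le> C * exp (ln C * \<bar>t - s\<bar>)"
      if st: "0 \<le> s" "0 \<le> t" for s t
    proof (rule onorm_bound)
      fix w :: "real^'n"
      \<comment> \<open>Every vector \<open>w\<close> is the value at \<open>s\<close> of some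
        solution, which turns the bound on solutions into one on the operator norm.\<close>
      obtain x where x: "solution x" "x s = w" by (rule solution_exists[OF st(1)])
      \<comment> \<open>Rounding up costs at most one extra step, hence the single factor
        \<open>C\<close> in front of the exponential.\<close>
      define n where "n = nat \<lceil>\<bar>t - s\<bar>\<rceil>"
      have "norm (transition_matrix A t s *v w) = norm (x t)"
        using transition[OF x(1) st] x(2) by simp
      also have "\<dots> \<le> C ^ n * norm (x s)"
      proof (rule norm_solution_le_power[OF _ _ st])
        show "\<bar>t - s\<bar> \<le> real n" by (simp add: n_def)
        show "norm (x t) \<le> C * norm (x s)" if "0 \<le> s" "0 \<le> t" "\<bar>t - s\<bar> \<le> 1" for s t
          using that by (intro C(2) x(1)) auto
      qed (use C(1) in simp)
      also have "C ^ n = exp (ln C * real n)"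
        using C(1) by (simp add: exp_of_nat2_mult)
      also have "\<dots> \<le> exp (ln C * (\<bar>t - s\<bar> + 1))"
        using C(1) by (auto simp: n_def intro!: mult_left_mono)
      also have "\<dots> = C * exp (ln C * \<bar>t - s\<bar>)"
        using C(1) by (simp add: distrib_left exp_add)
      finally show "norm (transition_matrix A t s *v w) \<le> C * exp (ln C * \<bar>t - s\<bar>) * norm w"
        using x(2) by (simp add: mult_right_mono)
    qed (use C(1) in simp)
    then show ?i using C(1) by (intro exI[of _ C] exI[of _ "ln C"] conjI) auto
  qed
  ultimately show ?thesis by blast
qed

end
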